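(* Let $G$ be a finite connected graph on $V(G)=\{x_1,\ldots,x_n\}$, and let $H_1,\ldots,H_n$ be finite graphs with $V(H_i)=\{z^{(i)}_1,\ldots,z^{(i)}_{r_i}\}$, $r_i\geq 1$, such that $V(G),V(H_1),\ldots,V(H_n)$ are pairwise disjoint. Then the graph $G(H_1,\ldots,H_n)$ is levelable if and only if each $H_i$ is levelable. In particular, if each $H_i$ is a complete graph $K_{r_i}$, then $G(H_1,\ldots,H_n)$ is levelable.
   Context: All graphs are finite and simple. $G(H_1,\ldots,H_n)$ denotes the graph on $V(G)\cup V(H_1)\cup\cdots\cup V(H_n)$ whose edge set is $$E(G)\cup E(H_1)\cup\cdots\cup E(H_n)\cup\{\{x_i,z^{(i)}_j\} : 1\leq i\leq n,\ 1\leq j\leq r_i\},$$ i.e. each vertex $x_i$ of $G$ is joined to every vertex of $H_i$. A graph on $\{v_1,\ldots,v_m\}$ is levelable if there exist positive integers $c_1,\ldots,c_m$ and a constant $c$ such that $\sum_{v_i\in W}c_i=c$ for every maximal (under inclusion) independent set $W$ of the graph. *)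

theory Defs
  imports Graph_Theory.Graph_Theory
begin

text \<open>
  A finite simple graph is an object of \<^locale>\<open>pair_graph\<close>: a finite vertex set together with a
  symmetric, loop-free set of arcs, the edge \<open>{u, v}\<close> being the pair of arcs \<open>(u, v)\<close>, \<open>(v, u)\<close>.
\<close>

definition independent_set :: "'a pair_pre_digraph \<Rightarrow> 'a set \<Rightarrow> bool" where
  "independent_set G W \<longleftrightarrow> W \<subseteq> pverts G \<and> (\<forall>u\<in>W. \<forall>v\<in>W. (u, v) \<notin> parcs G)"

definition maximal_independent_set :: "'a pair_pre_digraph \<Rightarrow> 'a set \<Rightarrow> bool" where
  "maximal_independent_set G W \<longleftrightarrow>
     independent_set G W \<and> (\<forall>W'. independent_set G W' \<and> W \<subseteq> W' \<longrightarrow> W' = W)"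

definition levelable :: "'a pair_pre_digraph \<Rightarrow> bool" where
  "levelable G \<longleftrightarrow>
     (\<exists>(c :: 'a \<Rightarrow> int) k. (\<forall>v\<in>pverts G. c v > 0) \<and>
        (\<forall>W. maximal_independent_set G W \<longrightarrow> (\<Sum>v\<in>W. c v) = k))"

text \<open>
  \<open>corona n x G H\<close> is \<open>G(H\<^sub>1, \<dots>, H\<^sub>n)\<close> for a graph \<open>G\<close> with vertices \<open>x 1, \<dots>, x n\<close>; only the
  values of \<open>x\<close> and \<open>H\<close> on \<open>{1..n}\<close> matter.
\<close>

definition corona ::
  "nat \<Rightarrow> (nat \<Rightarrow> 'a) \<Rightarrow> 'a pair_pre_digraph \<Rightarrow> (nat \<Rightarrow> 'a pair_pre_digraph) \<Rightarrow> 'a pair_pre_digraph"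
where
  "corona n x G H =
     \<lparr> pverts = pverts G \<union> (\<Union>i\<in>{1..n}. pverts (H i)),
       parcs = parcs G \<union> (\<Union>i\<in>{1..n}. parcs (H i)) \<union>
         (\<Union>i\<in>{1..n}. {x i} \<times> pverts (H i) \<union> pverts (H i) \<times> {x i}) \<rparr>"

lemma pair_graph_corona:
  assumes G: "pair_graph G" and H: "\<And>i. i \<in> {1..n} \<Longrightarrow> pair_graph (H i)"
    and x: "x ` {1..n} = pverts G"
    and disj: "\<And>i. i \<in> {1..n} \<Longrightarrow> pverts G \<inter> pverts (H i) = {}"
  shows "pair_graph (corona n x G H)"
proof -
  interpret G: pair_graph G by (fact G)
  have xG: "x i \<in> pverts G" if "i \<in> {1..n}" for i using x that by blast
  have fin: "finite (pverts (H i))" "finite (parcs (H i))" if "i \<in> {1..n}" for i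
  proof -
    interpret pair_graph "H i" by (rule H[OF that])
    show "finite (pverts (H i))" "finite (parcs (H i))"
      by (fact pair_finite_verts pair_finite_arcs)+
  qed
  have arc: "u \<in> pverts (H i) \<and> v \<in> pverts (H i) \<and> u \<noteq> v \<and> (v, u) \<in> parcs (H i)"
    if "i \<in> {1..n}" "(u, v) \<in> parcs (H i)" for i u v
  proof -
    interpret pair_graph "H i" by (rule H[OF that(1)])
    show ?thesis
      using that(2) wellformed' pair_no_loops pair_sym_arcs by (fastforce simp: symmetric_def sym_def)
  qed
  have arcG: "u \<in> pverts G \<and> v \<in> pverts G \<and> u \<noteq> v \<and> (v, u) \<in> parcs G"
    if "(u, v) \<in> parcs G" for u v
    using that G.wellformed' G.pair_no_loops G.pair_sym_arcs by (fastforce simp: symmetric_def sym_def)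
  let ?C = "corona n x G H"
  have arcC: "u \<in> pverts ?C \<and> v \<in> pverts ?C \<and> u \<noteq> v \<and> (v, u) \<in> parcs ?C"
    if "(u, v) \<in> parcs ?C" for u v
  proof -
    from that consider "(u, v) \<in> parcs G"
      | i where "i \<in> {1..n}" "(u, v) \<in> parcs (H i)"
      | i where "i \<in> {1..n}" "u = x i" "v \<in> pverts (H i)"
      | i where "i \<in> {1..n}" "v = x i" "u \<in> pverts (H i)"
      unfolding corona_def by auto
    then show ?thesis
    proof cases
      case 1
      then show ?thesis using arcG[OF 1] by (simp add: corona_def)
    next
      case 2
      then show ?thesis using arc[OF 2] by (auto simp: corona_def)
    next
      case 3
      have "u \<noteq> v" using 3 xG[OF 3(1)] disj[OF 3(1)] by blast
      then show ?thesis using 3 xG[OF 3(1)] by (auto simp: corona_def)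
    next
      case 4
      have "u \<noteq> v" using 4 xG[OF 4(1)] disj[OF 4(1)] by blast
      then show ?thesis using 4 xG[OF 4(1)] by (auto simp: corona_def)
    qed
  qed
  show ?thesis
  proof unfold_locales
    show "finite (pverts ?C)" "finite (parcs ?C)"
      using fin G.pair_finite_verts G.pair_finite_arcs by (auto simp: corona_def)
    show "symmetric ?C" using arcC by (auto simp: symmetric_def sym_def)
  qed (use arcC in force)+
qed

end

theory Submission
  imports Defs
begin

text \<open>
  A set \<open>W\<close> is a maximal independent set of \<open>G(H\<^sub>1, \<dots>, H\<^sub>n)\<close> exactly if it meets \<open>V(G)\<close> in an
  independent set (not necessarily a maximal one) and, for every \<open>i\<close>, either contains \<open>x\<^sub>i\<close> and misses
  \<open>V(H\<^sub>i)\<close>, or misses \<open>x\<^sub>i\<close> and meets \<open>V(H\<^sub>i)\<close> in a maximal independent set of \<open>H\<^sub>i\<close>.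
  Weights on the \<open>H\<^sub>i\<close> with constants \<open>k\<^sub>i\<close> therefore extend to the whole graph by giving \<open>x\<^sub>i\<close> the
  weight \<open>k\<^sub>i\<close>. Conversely, a union of maximal independent sets \<open>M\<^sub>i\<close> of the \<open>H\<^sub>i\<close> is a maximal
  independent set, and varying a single \<open>M\<^sub>i\<close> shows that the restriction of the weights levels \<open>H\<^sub>i\<close>.
\<close>

section \<open>Maximal independent sets in a single graph\<close>

lemma (in pair_graph) maximal_independent_set_iff:
  "maximal_independent_set G W \<longleftrightarrow>
     independent_set G W \<and> (\<forall>v\<in>pverts G - W. \<exists>u\<in>W. (v, u) \<in> parcs G)"
proof (intro iffI conjI ballI)
  assume W: "maximal_independent_set G W"
  then show I: "independent_set G W"
    by (simp add: maximal_independent_set_def)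
  fix v assume v: "v \<in> pverts G - W"
  \<comment> \<open>Testing one added vertex is enough: a conflict in \<open>insert v W\<close> must
    involve \<open>v\<close>, is not a loop, and by symmetry can be read as an arc from
    \<open>v\<close> into \<open>W\<close>.\<close>
  have "\<not> independent_set G (insert v W)"
    using W v unfolding maximal_independent_set_def by blast
  moreover have "(v, v) \<notin> parcs G"
    using pair_no_loops by fastforce
  moreover have "(v, u) \<in> parcs G" if "(u, v) \<in> parcs G" for u
    using pair_sym_arcs that by (auto simp: symmetric_def sym_def)
  ultimately show "\<exists>u\<in>W. (v, u) \<in> parcs G"
    using I v unfolding independent_set_def by blast
next
  assume "independent_set G W \<and> (\<forall>v\<in>pverts G - W. \<exists>u\<in>W. (v, u) \<in> parcs G)"
  then show "maximal_independent_set G W"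
    unfolding maximal_independent_set_def independent_set_def by blast
qed

text \<open>The family of independent sets is finite and contains the empty set. Existence is what
  forces the constant of each \<open>H i\<close> to be positive, and it supplies sets with which to
  fill the other blocks.\<close>

lemma (in pair_graph) maximal_independent_set_exists:
  "\<exists>W. maximal_independent_set G W"
proof -
  have "finite {W. independent_set G W}"
    by (rule finite_subset[of _ "Pow (pverts G)"]) (auto simp: independent_set_def)
  moreover have "{} \<in> {W. independent_set G W}"
    by (simp add: independent_set_def)
  ultimately obtain W where "independent_set G W"
      "\<And>W'. independent_set G W' \<Longrightarrow> W \<subseteq> W' \<Longrightarrow> W = W'"
    using finite_has_maximal[of "{W. independent_set G W}"] by blast
  then show ?thesis
    unfolding maximal_independent_set_def by blast
qed

text \<open>All maximal independent sets are singletons here, so constant weight 1 works.\<close>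

lemma levelable_complete:
  assumes "pair_graph G" and "pverts G \<noteq> {}" and "complete_digraph m (with_proj G)"
  shows "levelable G"
proof -
  interpret pair_graph G by fact
  have arcs: "(u, v) \<in> parcs G" if "u \<in> pverts G" "v \<in> pverts G" "u \<noteq> v" for u v
    using assms(3) that by (auto simp: complete_digraph_def arcs_ends_def arc_to_ends_def)
  have "(\<Sum>v\<in>W. 1) = (1 :: int)" if W: "maximal_independent_set G W" for W
  proof -
    have I: "independent_set G W" and M: "\<forall>v\<in>pverts G - W. \<exists>u\<in>W. (v, u) \<in> parcs G"
      using W by (simp_all add: maximal_independent_set_iff)
    have "W \<noteq> {}"
      using M \<open>pverts G \<noteq> {}\<close> by blast
    then obtain w where "w \<in> W" by blast
    then have "W = {w}"
      using I arcs unfolding independent_set_def by blast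
    then show ?thesis by simp
  qed
  then show ?thesis
    unfolding levelable_def by (intro exI[of _ "\<lambda>_. 1"] exI[of _ 1]) simp
qed

section \<open>The corona and its decomposition into blocks\<close>

locale corona_graphs =
  fixes n :: nat
    and x :: "nat \<Rightarrow> 'a"
    and G :: "'a pair_pre_digraph"
    and H :: "nat \<Rightarrow> 'a pair_pre_digraph"
  assumes pair_graph_G: "pair_graph G"
    and bij_x: "bij_betw x {1..n} (pverts G)"
    and pair_graph_H: "\<And>i. i \<in> {1..n} \<Longrightarrow> pair_graph (H i)"
    and H_nonempty: "\<And>i. i \<in> {1..n} \<Longrightarrow> pverts (H i) \<noteq> {}"
    and G_disjoint_H: "\<And>i. i \<in> {1..n} \<Longrightarrow> pverts G \<inter> pverts (H i) = {}"
    and H_disjoint_H: "\<And>i j. i \<in> {1..n} \<Longrightarrow> j \<in> {1..n} \<Longrightarrow> i \<noteq> j \<Longrightarrow>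
      pverts (H i) \<inter> pverts (H j) = {}"
begin

abbreviation C :: "'a pair_pre_digraph" where
  "C \<equiv> corona n x G H"

text \<open>The blocks partition the vertices of the corona, so every weight sum can be computed
  block by block.\<close>

definition block :: "nat \<Rightarrow> 'a set" where
  "block i = insert (x i) (pverts (H i))"

sublocale C: pair_graph C
  using pair_graph_corona[OF pair_graph_G pair_graph_H _ G_disjoint_H] bij_x
  by (simp add: bij_betw_def)

lemma x_in_G: "i \<in> {1..n} \<Longrightarrow> x i \<in> pverts G"
  using bij_x by (auto simp: bij_betw_def)

lemma notin_G: "i \<in> {1..n} \<Longrightarrow> v \<in> pverts (H i) \<Longrightarrow> v \<notin> pverts G"
  using G_disjoint_H by blast

lemma H_unique:
  assumes "i \<in> {1..n}" "j \<in> {1..n}" "v \<in> pverts (H i)" "v \<in> pverts (H j)"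
  shows "i = j"
  using assms H_disjoint_H[of i j] by (cases "i = j") auto

lemma x_notin_H: "i \<in> {1..n} \<Longrightarrow> j \<in> {1..n} \<Longrightarrow> x i \<notin> pverts (H j)"
  using x_in_G notin_G by metis

lemma pverts_C: "pverts C = (\<Union>i\<in>{1..n}. block i)"
  using bij_x by (auto simp: corona_def block_def bij_betw_def)

lemma block_unique:
  assumes "i \<in> {1..n}" "j \<in> {1..n}" "v \<in> block i" "v \<in> block j"
  shows "i = j"
proof -
  have "inj_on x {1..n}"
    using bij_x by (simp add: bij_betw_def)
  then show ?thesis
    using assms x_notin_H H_unique unfolding block_def by (metis inj_onD insert_iff)
qed

lemma finite_block: "i \<in> {1..n} \<Longrightarrow> finite (block i)"
  using C.pair_finite_verts by (simp add: pverts_C)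

lemma parcs_H_pverts:
  assumes "i \<in> {1..n}" "(u, v) \<in> parcs (H i)"
  shows "u \<in> pverts (H i)" "v \<in> pverts (H i)"
proof -
  interpret pair_graph "H i" using assms by (intro pair_graph_H)
  show "u \<in> pverts (H i)" "v \<in> pverts (H i)"
    using assms wellformed' by auto
qed

lemma parcs_G_pverts:
  assumes "(u, v) \<in> parcs G"
  shows "u \<in> pverts G" "v \<in> pverts G"
proof -
  interpret pair_graph G by (rule pair_graph_G)
  show "u \<in> pverts G" "v \<in> pverts G"
    using assms wellformed' by auto
qed

text \<open>Disjointness excludes every other kind of arc: \<open>x i\<close> is the only gateway
  out of \<open>H i\<close>. This lets each \<open>H i\<close> be treated on its own once
  \<open>x i\<close> is known to be absent.\<close>

lemma parcs_C_H_iff: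
  assumes i: "i \<in> {1..n}" and v: "v \<in> pverts (H i)"
  shows "(v, u) \<in> parcs C \<longleftrightarrow> (v, u) \<in> parcs (H i) \<or> u = x i"
proof
  assume "(v, u) \<in> parcs C"
  then consider "(v, u) \<in> parcs G" | j where "j \<in> {1..n}" "(v, u) \<in> parcs (H j)"
    | j where "j \<in> {1..n}" "v = x j" | j where "j \<in> {1..n}" "v \<in> pverts (H j)" "u = x j"
    by (auto simp: corona_def)
  then show "(v, u) \<in> parcs (H i) \<or> u = x i"
  proof cases
    case 1
    then show ?thesis using parcs_G_pverts notin_G[OF i v] by blast
  next
    case (2 j)
    then show ?thesis using parcs_H_pverts H_unique[OF i _ v] by metis
  next
    case (3 j)
    then show ?thesis using x_notin_H[OF _ i] v by blast
  next
    case (4 j)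
    then show ?thesis using H_unique[OF i _ v] by blast
  qed
qed (use i v in \<open>auto simp: corona_def\<close>)

lemma parcs_C_x_H: "i \<in> {1..n} \<Longrightarrow> v \<in> pverts (H i) \<Longrightarrow> (x i, v) \<in> parcs C"
  by (auto simp: corona_def)

section \<open>Maximal independent sets of the corona\<close>

lemma maximal_independent_set_nonempty:
  "i \<in> {1..n} \<Longrightarrow> maximal_independent_set (H i) M \<Longrightarrow> M \<noteq> {}"
  using H_nonempty pair_graph.maximal_independent_set_iff[OF pair_graph_H] by blast

text \<open>If \<open>x i\<close> lies in \<open>W\<close>, it excludes all its neighbours in
  \<open>H i\<close>. Otherwise a vertex of \<open>H i\<close> outside \<open>W\<close> still needs
  a neighbour in \<open>W\<close>, and with \<open>x i\<close> absent that neighbour lies in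
  \<open>H i\<close>.\<close>

lemma maximal_independent_set_block:
  assumes W: "maximal_independent_set C W" and i: "i \<in> {1..n}"
  shows "W \<inter> block i = {x i} \<or> maximal_independent_set (H i) (W \<inter> block i)"
proof (cases "x i \<in> W")
  case True
  then have "W \<inter> pverts (H i) = {}"
    using W parcs_C_x_H[OF i] unfolding C.maximal_independent_set_iff independent_set_def by blast
  then show ?thesis
    using True unfolding block_def by blast
next
  case False
  then have eq: "W \<inter> block i = W \<inter> pverts (H i)"
    by (auto simp: block_def)
  have "independent_set (H i) (W \<inter> pverts (H i))"
    using W parcs_C_H_iff[OF i]
    unfolding C.maximal_independent_set_iff independent_set_def by blast
  moreover have "\<exists>u\<in>W \<inter> pverts (H i). (v, u) \<in> parcs (H i)"
    if v: "v \<in> pverts (H i) - W \<inter> pverts (H i)" for v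
  proof -
    have "v \<in> pverts C - W"
      using v i by (auto simp: pverts_C block_def)
    then obtain u where "u \<in> W" "(v, u) \<in> parcs C"
      using W unfolding C.maximal_independent_set_iff by blast
    then show ?thesis
      using False parcs_C_H_iff[OF i] parcs_H_pverts[OF i] v by blast
  qed
  ultimately show ?thesis
    unfolding eq pair_graph.maximal_independent_set_iff[OF pair_graph_H[OF i]] by blast
qed

lemma maximal_independent_set_UN:
  assumes M: "\<And>i. i \<in> {1..n} \<Longrightarrow> maximal_independent_set (H i) (M i)"
  shows "maximal_independent_set C (\<Union>i\<in>{1..n}. M i)"
proof -
  have sub: "M i \<subseteq> pverts (H i)" if "i \<in> {1..n}" for i
    using M[OF that] by (simp add: maximal_independent_set_def independent_set_def)
  have indep: "(u, v) \<notin> parcs C"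
    if "i \<in> {1..n}" "j \<in> {1..n}" "u \<in> M i" "v \<in> M j" for i j u v
  proof
    have u: "u \<in> pverts (H i)" and v: "v \<in> pverts (H j)"
      using sub that by auto
    have "v \<noteq> x i"
      using v x_notin_H[OF that(1,2)] by blast
    moreover assume "(u, v) \<in> parcs C"
    ultimately have "(u, v) \<in> parcs (H i)"
      using parcs_C_H_iff[OF that(1) u] by blast
    moreover from this have "i = j"
      using parcs_H_pverts(2)[OF that(1)] H_unique[OF that(1,2) _ v] by blast
    ultimately show False
      using M[OF that(1)] that unfolding maximal_independent_set_def independent_set_def by blast
  qed
  \<comment> \<open>No vertex of \<open>G\<close> can be added either: \<open>x i\<close> is
    adjacent to all of \<open>M i\<close>, which is nonempty because \<open>H i\<close> has a
    vertex.\<close>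
  have dom: "\<exists>u\<in>M i. (v, u) \<in> parcs C" if i: "i \<in> {1..n}" and v: "v \<in> block i - M i" for i v
  proof (cases "v = x i")
    case True
    then show ?thesis
      using maximal_independent_set_nonempty[OF i M[OF i]] sub[OF i] parcs_C_x_H[OF i] by blast
  next
    case False
    then have "v \<in> pverts (H i)" "v \<in> pverts (H i) - M i"
      using v by (auto simp: block_def)
    then show ?thesis
      using M[OF i] parcs_C_H_iff[OF i]
      unfolding pair_graph.maximal_independent_set_iff[OF pair_graph_H[OF i]] by blast
  qed
  show ?thesis
    unfolding C.maximal_independent_set_iff independent_set_def
  proof (intro conjI ballI)
    show "(\<Union>i\<in>{1..n}. M i) \<subseteq> pverts C"
      using sub unfolding pverts_C block_def by blast
  next
    fix u v assume "u \<in> (\<Union>i\<in>{1..n}. M i)" "v \<in> (\<Union>i\<in>{1..n}. M i)"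
    then show "(u, v) \<notin> parcs C"
      using indep by blast
  next
    fix v assume "v \<in> pverts C - (\<Union>i\<in>{1..n}. M i)"
    then obtain i where "i \<in> {1..n}" "v \<in> block i - M i"
      unfolding pverts_C by blast
    then show "\<exists>u\<in>(\<Union>i\<in>{1..n}. M i). (v, u) \<in> parcs C"
      using dom by blast
  qed
qed

section \<open>Transfer of weights between the corona and the graphs \<open>H i\<close>\<close>

lemma sum_blocks:
  fixes c :: "'a \<Rightarrow> int"
  assumes "W \<subseteq> pverts C"
  shows "(\<Sum>v\<in>W. c v) = (\<Sum>i\<in>{1..n}. \<Sum>v\<in>W \<inter> block i. c v)"
proof -
  have "W = (\<Union>i\<in>{1..n}. W \<inter> block i)"
    using assms by (auto simp: pverts_C)
  then have "(\<Sum>v\<in>W. c v) = (\<Sum>v\<in>(\<Union>i\<in>{1..n}. W \<inter> block i). c v)"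
    by (rule arg_cong)
  also have "\<dots> = (\<Sum>i\<in>{1..n}. \<Sum>v\<in>W \<inter> block i. c v)"
    using finite_block block_unique by (intro sum.UNION_disjoint) auto
  finally show ?thesis .
qed

lemma levelable_corona:
  assumes "\<forall>i\<in>{1..n}. levelable (H i)"
  shows "levelable C"
proof -
  have "\<exists>d k. (\<forall>v\<in>pverts (H i). d v > (0 :: int)) \<and>
      (\<forall>M. maximal_independent_set (H i) M \<longrightarrow> (\<Sum>v\<in>M. d v) = k)" if "i \<in> {1..n}" for i
    using assms that unfolding levelable_def by blast
  then obtain d :: "nat \<Rightarrow> 'a \<Rightarrow> int" and k :: "nat \<Rightarrow> int" where
    d_pos: "\<And>i v. i \<in> {1..n} \<Longrightarrow> v \<in> pverts (H i) \<Longrightarrow> d i v > 0" and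
    d_sum: "\<And>i M. i \<in> {1..n} \<Longrightarrow> maximal_independent_set (H i) M \<Longrightarrow> (\<Sum>v\<in>M. d i v) = k i"
    by metis
  \<comment> \<open>Needed because \<open>k i\<close> becomes the weight of
    \<open>x i\<close>.\<close>
  have k_pos: "k i > 0" if i: "i \<in> {1..n}" for i
  proof -
    interpret pair_graph "H i" using i by (rule pair_graph_H)
    obtain M where M: "maximal_independent_set (H i) M"
      using maximal_independent_set_exists by blast
    have sub: "M \<subseteq> pverts (H i)"
      using M by (simp add: maximal_independent_set_def independent_set_def)
    have "(\<Sum>v\<in>M. d i v) > 0"
      using maximal_independent_set_nonempty[OF i M] sub d_pos[OF i]
      by (intro sum_pos) (auto intro: finite_subset)
    then show ?thesis
      using d_sum[OF i M] by simp
  qed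
  \<comment> \<open>The index of the block containing \<open>v\<close>; since blocks do not overlap,
    the choice is forced on vertices of the corona.\<close>
  define ix where "ix v = (SOME i. i \<in> {1..n} \<and> v \<in> block i)" for v
  have ix: "ix v = i" if "i \<in> {1..n}" "v \<in> block i" for i v
    unfolding ix_def using that block_unique by (intro some_equality) auto
  define c where "c v = (if v = x (ix v) then k (ix v) else d (ix v) v)" for v
  have c_x: "c (x i) = k i" if "i \<in> {1..n}" for i
    using ix[OF that, of "x i"] by (simp add: c_def block_def)
  have c_H: "c v = d i v" if "i \<in> {1..n}" "v \<in> pverts (H i)" for i v
  proof -
    have "ix v = i" "v \<noteq> x i"
      using ix[OF that(1), of v] x_notin_H[OF that(1,1)] that by (auto simp: block_def)
    then show ?thesis by (simp add: c_def)
  qed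
  have "c v > 0" if "v \<in> pverts C" for v
    using that k_pos d_pos c_x c_H by (auto simp: pverts_C block_def)
  moreover have "(\<Sum>v\<in>W. c v) = (\<Sum>i\<in>{1..n}. k i)" if W: "maximal_independent_set C W" for W
  proof -
    \<comment> \<open>Both shapes of \<open>W\<close> on a block contribute the same amount, so the
      total does not depend on \<open>W\<close>.\<close>
    have "(\<Sum>v\<in>W \<inter> block i. c v) = k i" if i: "i \<in> {1..n}" for i
      using maximal_independent_set_block[OF W i]
    proof
      assume M: "maximal_independent_set (H i) (W \<inter> block i)"
      then have "W \<inter> block i \<subseteq> pverts (H i)"
        by (simp add: maximal_independent_set_def independent_set_def)
      then have "(\<Sum>v\<in>W \<inter> block i. c v) = (\<Sum>v\<in>W \<inter> block i. d i v)"
        using c_H[OF i] by (intro sum.cong) auto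
      then show ?thesis
        using d_sum[OF i M] by simp
    qed (simp add: c_x[OF i])
    moreover have "W \<subseteq> pverts C"
      using W by (simp add: maximal_independent_set_def independent_set_def)
    ultimately show ?thesis
      by (simp add: sum_blocks)
  qed
  ultimately show ?thesis
    unfolding levelable_def by blast
qed

lemma levelable_if_levelable_corona:
  assumes "levelable C" and i: "i \<in> {1..n}"
  shows "levelable (H i)"
proof -
  obtain c k where c_pos: "\<And>v. v \<in> pverts C \<Longrightarrow> c v > (0 :: int)"
    and c_sum: "\<And>W. maximal_independent_set C W \<Longrightarrow> (\<Sum>v\<in>W. c v) = k"
    using assms(1) unfolding levelable_def by blast
  \<comment> \<open>This family is fixed before \<open>M\<close> is introduced, so the right-hand
    side of the next equation does not depend on \<open>M\<close> and can serve as the constant for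
    \<open>H i\<close>.\<close>
  obtain N where N: "\<And>j. j \<in> {1..n} \<Longrightarrow> maximal_independent_set (H j) (N j)"
    using pair_graph.maximal_independent_set_exists[OF pair_graph_H] by metis
  have "(\<Sum>v\<in>M. c v) = k - (\<Sum>j\<in>{1..n} - {i}. \<Sum>v\<in>N j. c v)"
    if M: "maximal_independent_set (H i) M" for M
  proof -
    define N' where "N' = N(i := M)"
    have N': "maximal_independent_set (H j) (N' j)" if "j \<in> {1..n}" for j
      using N M that by (simp add: N'_def)
    have sub: "N' j \<subseteq> block j" if "j \<in> {1..n}" for j
      using N'[OF that] by (auto simp: maximal_independent_set_def independent_set_def block_def)
    have eq: "(\<Union>j\<in>{1..n}. N' j) \<inter> block j = N' j" if "j \<in> {1..n}" for j
      using sub that block_unique by blast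
    have "k = (\<Sum>v\<in>(\<Union>j\<in>{1..n}. N' j). c v)"
      using c_sum[OF maximal_independent_set_UN[OF N']] by simp
    also have "\<dots> = (\<Sum>j\<in>{1..n}. \<Sum>v\<in>(\<Union>j\<in>{1..n}. N' j) \<inter> block j. c v)"
      by (rule sum_blocks) (use sub in \<open>unfold pverts_C, blast\<close>)
    also have "\<dots> = (\<Sum>j\<in>{1..n}. \<Sum>v\<in>N' j. c v)"
      by (intro sum.cong refl) (simp only: eq)
    \<comment> \<open>Splitting off index \<open>i\<close> isolates the only term involving
      \<open>M\<close>, since \<open>N'\<close> agrees with \<open>N\<close> elsewhere.\<close>
    also have "\<dots> = (\<Sum>v\<in>M. c v) + (\<Sum>j\<in>{1..n} - {i}. \<Sum>v\<in>N' j. c v)"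
      by (subst sum.remove[OF _ i]) (simp_all add: N'_def)
    also have "(\<Sum>j\<in>{1..n} - {i}. \<Sum>v\<in>N' j. c v) = (\<Sum>j\<in>{1..n} - {i}. \<Sum>v\<in>N j. c v)"
      by (intro sum.cong) (auto simp: N'_def)
    finally show ?thesis by simp
  qed
  moreover have "c v > 0" if "v \<in> pverts (H i)" for v
    using i that by (intro c_pos) (auto simp: corona_def)
  ultimately show ?thesis
    unfolding levelable_def by blast
qed

end

theorem theorem3p7:
  fixes n :: nat
    and x :: "nat \<Rightarrow> 'a"
    and r :: "nat \<Rightarrow> nat"
    and G :: "'a pair_pre_digraph"
    and H :: "nat \<Rightarrow> 'a pair_pre_digraph"
  assumes "pair_graph G" and "connected (with_proj G)"
    and "bij_betw x {1..n} (pverts G)"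
    and "\<And>i. i \<in> {1..n} \<Longrightarrow> pair_graph (H i)"
    and "\<And>i. i \<in> {1..n} \<Longrightarrow> card (pverts (H i)) = r i"
    and "\<And>i. i \<in> {1..n} \<Longrightarrow> r i \<ge> 1"
    and "\<And>i. i \<in> {1..n} \<Longrightarrow> pverts G \<inter> pverts (H i) = {}"
    and "\<And>i j. i \<in> {1..n} \<Longrightarrow> j \<in> {1..n} \<Longrightarrow> i \<noteq> j \<Longrightarrow> pverts (H i) \<inter> pverts (H j) = {}"
  shows "(levelable (corona n x G H) \<longleftrightarrow> (\<forall>i\<in>{1..n}. levelable (H i))) \<and>
         ((\<forall>i\<in>{1..n}. complete_digraph (r i) (with_proj (H i))) \<longrightarrow> levelable (corona n x G H))"
proof -
  have nonempty: "pverts (H i) \<noteq> {}" if "i \<in> {1..n}" for i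
    using assms(5,6)[OF that] by auto
  interpret corona_graphs n x G H
    by (rule corona_graphs.intro) (use assms nonempty in auto)
  have "levelable (H i)" if "i \<in> {1..n}" "complete_digraph (r i) (with_proj (H i))" for i
    using levelable_complete assms(4) nonempty that by blast
  then show ?thesis
    using levelable_corona levelable_if_levelable_corona by blast
qed

end
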